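(* Let $c\in\{c_{\mathsf{All}},c_{\mathsf{None}},c_{\mathsf{Match}}\}$. For every SPARQL graph pattern $P$ there exists an LDQL query $q$ such that $[\![P]\!]^{\mathsf R(c,S)}_W=[\![q]\!]^S_W$ for every Web of Linked Data $W$ and every finite $S\subseteq\mathcal U$.
   Context: **Data model.** $\mathcal U$ (URIs), $\mathcal B$ (blank nodes), $\mathcal L$ (literals), $\mathcal V$ (variables, written $?v,?x,\dots$) and $\mathcal D$ (documents) are pairwise disjoint infinite sets. An RDF triple is an element of $\mathcal T=(\mathcal U\cup\mathcal B)\times\mathcal U\times(\mathcal U\cup\mathcal B\cup\mathcal L)$; $\mathrm{uris}(t)$ is the set of URIs in the triple $t$. Each document $d$ carries a finite set of triples $\mathrm{data}(d)\subseteq\mathcal T$, distinct documents using disjoint sets of blank nodes. A Web of Linked Data is $W=\langle D,adoc\rangle$ with $D\subseteq\mathcal D$ finite and $adoc:\mathcal U\to D$ a partial surjective function with domain $\mathrm{dom}(adoc)$. When quantifying over all Webs, the assignment $\mathrm{data}$ also varies over all possibilities. The link graph $\mathcal G_W$ has node set $D$ and edges $\langle d,(t,u),d'\rangle$ for all $d\in D$, $t\in\mathrm{data}(d)$, $u\in\mathrm{uris}(t)\cap\mathrm{dom}(adoc)$, $d'=adoc(u)$. **SPARQL.** A solution mapping $\mu$ is a partial function with finite domain from $\mathcal V$ to $\mathcal U\cup\mathcal B\cup\mathcal L$; $\mu[\alpha]=\mu(\alpha)$ if $\alpha\in\mathrm{dom}(\mu)$, else $\mu[\alpha]=\alpha$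 (extended componentwise to triples). $\mu,\mu'$ are compatible if they agree on $\mathrm{dom}(\mu)\cap\mathrm{dom}(\mu')$. $\Omega_1\Join\Omega_2=\{\mu_1\cup\mu_2\mid\mu_i\in\Omega_i\text{ compatible}\}$. An RDF dataset $\mathfrak D$ consists of a default graph and finitely or infinitely many named graphs $\langle u,G_u\rangle$ with pairwise distinct names $u\in\mathcal U$. Graph patterns: finite sets $B$ of triple patterns from $(\mathcal U\cup\mathcal L\cup\mathcal V)\times(\mathcal U\cup\mathcal V)\times(\mathcal U\cup\mathcal L\cup\mathcal V)$ (basic graph patterns, possibly the empty one $\{\,\}$; a triple pattern is identified with a singleton), and $(P_1\,\mathsf{AND}\,P_2)$, $(P_1\,\mathsf{UNION}\,P_2)$, $(P_1\,\mathsf{OPT}\,P_2)$, $(P_1\,\mathsf{FILTER}\,R)$, $(\mathsf{GRAPH}\ c\ P_1)$ with $c\in\mathcal U\cup\mathcal V$, $(P_1\,\mathsf{BIND}(e\,\mathsf{AS}\,?v))$ with $e\in\mathcal U\cup\mathcal L\cup\mathcal V$ and $?v$ not occurring in $P_1$. Filter conditions are Boolean combinations of $\mathrm{bound}(?x)$, $?x=c$, $?x=?y$ (atoms with an unbound variable are false). Evaluation $[\![P]\!]^{\mathfrak D}_G$: $[\![B]\!]=\{\mu\mid\mathrm{dom}(\mu)=\mathrm{var}(B),\mu[B]\subseteq G\}$; $\mathsf{AND}$ is $\Join$; $\mathsf{UNION}$ is $\cup$; $\mathsf{OPT}$ gives $(\Omega_1\Join\Omega_2)\cup\{\mu\in\Omega_1\mid\text{no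 }\mu'\in\Omega_2\text{ compatible with }\mu\}$; $\mathsf{FILTER}$ selects the mappings satisfying $R$; $[\![\mathsf{GRAPH}\ u\ P_1]\!]^{\mathfrak D}_G=[\![P_1]\!]^{\mathfrak D}_{G_u}$ ($G_u=\emptyset$ if $u$ is not a name in $\mathfrak D$); $[\![\mathsf{GRAPH}\ ?x\ P_1]\!]^{\mathfrak D}_G=\bigcup_{u\text{ name in }\mathfrak D}([\![P_1]\!]^{\mathfrak D}_{G_u}\Join\{\{?x\mapsto u\}\})$; $\mathsf{BIND}$ extends each mapping $\mu$ by $?v\mapsto\mu[e]$ (leaving $\mu$ unchanged if $e$ is an unbound variable). $[\![P]\!]_G$ (without dataset) means evaluation over $G$ in the dataset with default graph $G$ and no named graphs. **LDQL.** A link pattern is a tuple in $(\mathcal U\cup\{\_,+\})\times(\mathcal U\cup\{\_,+\})\times(\mathcal U\cup\mathcal L\cup\{\_,+\})$. An edge with label $(\langle x_1,x_2,x_3\rangle,u)$ matches $\langle y_1,y_2,y_3\rangle$ in the context of URI $u_c$ if (1) some $i$ has $y_i=\_$ and $x_i=u$, and (2) for each $i$: $y_i=+$ and $x_i=u_c$, or $y_i=x_i$, or $y_i=\_$. LDQL queries $q$ and link path expressions (LPEs) $lpe$ are given by $q:=\langle lpe,P\rangle\mid(\mathsf{SEED}\ U\ q)\mid(\mathsf{SEED}\ ?v\ q)\mid(q\,\mathsf{AND}\,q)\mid(q\,\mathsf{UNION}\,q)\mid\pi_Vq$, $lpe:=\varepsilon\mid lp\mid lpe/lpe\mid lpe|lpe\mid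 lpe^*\mid[lpe]\mid\langle ?v,q\rangle$, with $lp$ a link pattern, $P$ a graph pattern, $U$ a finite set of URIs, $V$ a finite set of variables. $\mathrm{dataset}_W(U)$ is the dataset with default graph $\bigcup_{u\in U\cap\mathrm{dom}(adoc)}\mathrm{data}(adoc(u))$ and named graphs $\langle u,\mathrm{data}(adoc(u))\rangle$ for $u\in U\cap\mathrm{dom}(adoc)$. For finite $S\subseteq\mathcal U$: $[\![\langle lpe,P\rangle]\!]^S_W=[\![P]\!]^{\mathfrak D}_G$ with $\mathfrak D=\mathrm{dataset}_W(\bigcup_{u\in S}[\![lpe]\!]^u_W)$ and $G$ its default graph; $[\![(\mathsf{SEED}\ U\ q)]\!]^S_W=[\![q]\!]^U_W$; $[\![(\mathsf{SEED}\ ?v\ q)]\!]^S_W=\bigcup_{u\in\mathcal U}([\![q]\!]^{\{u\}}_W\Join\{\{?v\mapsto u\}\})$; $\mathsf{UNION}$ is $\cup$; $\mathsf{AND}$ is $\Join$; $[\![\pi_Vq]\!]^S_W$ consists of the restrictions of the mappings in $[\![q]\!]^S_W$ to $V$. For $u_c\in\mathrm{dom}(adoc)$: $[\![\varepsilon]\!]^{u_c}_W=\{u_c\}$; $[\![lp]\!]^{u_c}_W$ is the set of URIs $u$ such that some edge $\langle adoc(u_c),(t,u),d'\rangle\in\mathcal G_W$ matches $lp$ in the context of $u_c$; $[\![l_1/l_2]\!]^{u_c}_W=\bigcup_{u'\in[\![l_1]\!]^{u_c}_W}[\![l_2]\!]^{u'}_W$; $[\![l_1|l_2]\!]^{u_c}_W$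 is the union; $[\![l^*]\!]^{u_c}_W=\{u_c\}\cup[\![l]\!]^{u_c}_W\cup[\![l/l]\!]^{u_c}_W\cup\cdots$; $[\![[l]]\!]^{u_c}_W=\{u_c\}$ if $[\![l]\!]^{u_c}_W\ne\emptyset$, else $\emptyset$; $[\![\langle ?v,q\rangle]\!]^{u_c}_W=\{u\in\mathcal U\mid\mu(?v)=u\text{ for some }\mu\in[\![q]\!]^{\{u_c\}}_W\}$. If $u_c\notin\mathrm{dom}(adoc)$ then $[\![lpe]\!]^{u_c}_W=\emptyset$. **Reachability-based semantics.** Let $\mathcal P$ be the set of all SPARQL graph patterns. A reachability criterion is a function $c:\mathcal T\times\mathcal U\times\mathcal P\to\{\mathrm{true},\mathrm{false}\}$. $c_{\mathsf{All}}$ is constantly true, $c_{\mathsf{None}}$ constantly false, and $c_{\mathsf{Match}}(t,u,P)=\mathrm{true}$ iff there are a triple pattern $tp$ contained in $P$ and a solution mapping $\mu$ with $\mu[tp]=t$. For finite $S\subseteq\mathcal U$, the $(c,S,P)$-reachable documents in $W$ form the smallest set such that: (1) $adoc(u)$ is reachable for each $u\in S\cap\mathrm{dom}(adoc)$; (2) if $\langle d,(t,u),d'\rangle\in\mathcal G_W$, $d$ is reachable and $c(t,u,P)=\mathrm{true}$, then $d'$ is reachable. $[\![P]\!]^{\mathsf R(c,S)}_W=[\![P]\!]_G$, where $G$ is the union of $\mathrm{data}(d)$ over all $(c,S,P)$-reachable documents $d$ in $W$. *)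

theory Defs
  imports Main "HOL-Library.FSet" "HOL-Library.Infinite_Typeclass"
begin

section \<open>Data model\<close>

text \<open>
  URIs, blank nodes, literals, variables and documents are the elements of the types
  \<open>'u\<close>, \<open>'b\<close>, \<open>'l\<close>, \<open>'v\<close> and \<open>'d\<close>; pairwise disjointness is provided by the constructors
  below, and infinity by the type class \<open>infinite\<close>.
\<close>

datatype ('u, 'b, 'l) rdf_term = Uri 'u | Blank 'b | Lit 'l

type_synonym ('u, 'b, 'l) rdf_triple =
  "('u, 'b, 'l) rdf_term \<times> ('u, 'b, 'l) rdf_term \<times> ('u, 'b, 'l) rdf_term"

definition rdf_triples :: "('u, 'b, 'l) rdf_triple set" where
  "rdf_triples = (range Uri \<union> range Blank) \<times> range Uri \<times> (range Uri \<union> range Blank \<union> range Lit)"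

fun terms_of :: "('u, 'b, 'l) rdf_triple \<Rightarrow> ('u, 'b, 'l) rdf_term set" where
  "terms_of (x1, x2, x3) = {x1, x2, x3}"

definition uris :: "('u, 'b, 'l) rdf_triple \<Rightarrow> 'u set" where
  "uris t = {u. Uri u \<in> terms_of t}"

definition blanks :: "('u, 'b, 'l) rdf_triple set \<Rightarrow> 'b set" where
  "blanks G = {b. \<exists>t\<in>G. Blank b \<in> terms_of t}"

text \<open>
  The assignment \<open>data\<close> of triples to all documents (not only those in \<open>docs\<close>) is a component
  of the record, so that quantifying over Webs also quantifies over this assignment.
\<close>

record ('u, 'b, 'l, 'd) web =
  docs :: "'d set"
  adoc :: "'u \<rightharpoonup> 'd"
  data :: "'d \<Rightarrow> ('u, 'b, 'l) rdf_triple set"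

definition is_web :: "('u, 'b, 'l, 'd) web \<Rightarrow> bool" where
  "is_web W \<longleftrightarrow>
     finite (docs W) \<and>
     ran (adoc W) = docs W \<and>
     (\<forall>d. finite (data W d) \<and> data W d \<subseteq> rdf_triples) \<and>
     (\<forall>d d'. d \<noteq> d' \<longrightarrow> blanks (data W d) \<inter> blanks (data W d') = {})"

definition link_graph ::
    "('u, 'b, 'l, 'd) web \<Rightarrow> ('d \<times> (('u, 'b, 'l) rdf_triple \<times> 'u) \<times> 'd) set" where
  "link_graph W = {(d, (t, u), d') | d t u d'.
     d \<in> docs W \<and> t \<in> data W d \<and> u \<in> uris t \<and> adoc W u = Some d'}"


section \<open>SPARQL\<close>

text \<open>Elements of \<open>\<U> \<union> \<B> \<union> \<L> \<union> \<V>\<close>.\<close>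

datatype ('u, 'b, 'l, 'v) elem = Term "('u, 'b, 'l) rdf_term" | Var 'v

type_synonym ('u, 'b, 'l, 'v) triple_pattern =
  "('u, 'b, 'l, 'v) elem \<times> ('u, 'b, 'l, 'v) elem \<times> ('u, 'b, 'l, 'v) elem"

definition pattern_elems :: "('u, 'b, 'l, 'v) elem set" where
  "pattern_elems = range (\<lambda>u. Term (Uri u)) \<union> range (\<lambda>l. Term (Lit l)) \<union> range Var"

definition triple_patterns :: "('u, 'b, 'l, 'v) triple_pattern set" where
  "triple_patterns =
     pattern_elems \<times> (range (\<lambda>u. Term (Uri u)) \<union> range Var) \<times> pattern_elems"

fun elem_vars :: "('u, 'b, 'l, 'v) elem \<Rightarrow> 'v set" where
  "elem_vars (Term t) = {}"
| "elem_vars (Var x) = {x}"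

fun tp_vars :: "('u, 'b, 'l, 'v) triple_pattern \<Rightarrow> 'v set" where
  "tp_vars (x1, x2, x3) = elem_vars x1 \<union> elem_vars x2 \<union> elem_vars x3"

subsection \<open>Solution mappings\<close>

type_synonym ('u, 'b, 'l, 'v) mapping = "'v \<rightharpoonup> ('u, 'b, 'l) rdf_term"

definition is_solution_mapping :: "('u, 'b, 'l, 'v) mapping \<Rightarrow> bool" where
  "is_solution_mapping \<mu> \<longleftrightarrow> finite (dom \<mu>)"

fun inst :: "('u, 'b, 'l, 'v) mapping \<Rightarrow> ('u, 'b, 'l, 'v) elem \<Rightarrow> ('u, 'b, 'l, 'v) elem" where
  "inst \<mu> (Term t) = Term t"
| "inst \<mu> (Var x) = (case \<mu> x of Some t \<Rightarrow> Term t | None \<Rightarrow> Var x)"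

fun inst_tp ::
    "('u, 'b, 'l, 'v) mapping \<Rightarrow> ('u, 'b, 'l, 'v) triple_pattern \<Rightarrow> ('u, 'b, 'l, 'v) triple_pattern" where
  "inst_tp \<mu> (x1, x2, x3) = (inst \<mu> x1, inst \<mu> x2, inst \<mu> x3)"

text \<open>The inclusion of RDF triples into triples over \<open>\<U> \<union> \<B> \<union> \<L> \<union> \<V>\<close>.\<close>

fun emb :: "('u, 'b, 'l) rdf_triple \<Rightarrow> ('u, 'b, 'l, 'v) triple_pattern" where
  "emb (x1, x2, x3) = (Term x1, Term x2, Term x3)"

definition compatible :: "('u, 'b, 'l, 'v) mapping \<Rightarrow> ('u, 'b, 'l, 'v) mapping \<Rightarrow> bool" where
  "compatible \<mu> \<mu>' \<longleftrightarrow> (\<forall>x \<in> dom \<mu> \<inter> dom \<mu>'. \<mu> x = \<mu>' x)"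

definition join ::
    "('u, 'b, 'l, 'v) mapping set \<Rightarrow> ('u, 'b, 'l, 'v) mapping set \<Rightarrow> ('u, 'b, 'l, 'v) mapping set"
    (infixl "\<Join>" 70) where
  "\<Omega>1 \<Join> \<Omega>2 = {\<mu>1 ++ \<mu>2 | \<mu>1 \<mu>2. \<mu>1 \<in> \<Omega>1 \<and> \<mu>2 \<in> \<Omega>2 \<and> compatible \<mu>1 \<mu>2}"

subsection \<open>Filter conditions\<close>

datatype ('u, 'b, 'l, 'v) condition =
    Bound 'v
  | EqConst 'v "('u, 'b, 'l) rdf_term"
  | EqVar 'v 'v
  | Neg "('u, 'b, 'l, 'v) condition"
  | Conj "('u, 'b, 'l, 'v) condition" "('u, 'b, 'l, 'v) condition"
  | Disj "('u, 'b, 'l, 'v) condition" "('u, 'b, 'l, 'v) condition"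

text \<open>As in triple patterns, constants are URIs or literals.\<close>

primrec wf_condition :: "('u, 'b, 'l, 'v) condition \<Rightarrow> bool" where
  "wf_condition (Bound x) = True"
| "wf_condition (EqConst x c) = (c \<in> range Uri \<union> range Lit)"
| "wf_condition (EqVar x y) = True"
| "wf_condition (Neg R) = wf_condition R"
| "wf_condition (Conj R1 R2) = (wf_condition R1 \<and> wf_condition R2)"
| "wf_condition (Disj R1 R2) = (wf_condition R1 \<and> wf_condition R2)"

primrec cond_vars :: "('u, 'b, 'l, 'v) condition \<Rightarrow> 'v set" where
  "cond_vars (Bound x) = {x}"
| "cond_vars (EqConst x c) = {x}"
| "cond_vars (EqVar x y) = {x, y}"
| "cond_vars (Neg R) = cond_vars R"
| "cond_vars (Conj R1 R2) = cond_vars R1 \<union> cond_vars R2"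
| "cond_vars (Disj R1 R2) = cond_vars R1 \<union> cond_vars R2"

primrec satisfies :: "('u, 'b, 'l, 'v) mapping \<Rightarrow> ('u, 'b, 'l, 'v) condition \<Rightarrow> bool" where
  "satisfies \<mu> (Bound x) = (x \<in> dom \<mu>)"
| "satisfies \<mu> (EqConst x c) = (\<mu> x = Some c)"
| "satisfies \<mu> (EqVar x y) = (x \<in> dom \<mu> \<and> y \<in> dom \<mu> \<and> \<mu> x = \<mu> y)"
| "satisfies \<mu> (Neg R) = (\<not> satisfies \<mu> R)"
| "satisfies \<mu> (Conj R1 R2) = (satisfies \<mu> R1 \<and> satisfies \<mu> R2)"
| "satisfies \<mu> (Disj R1 R2) = (satisfies \<mu> R1 \<or> satisfies \<mu> R2)"

subsection \<open>Graph patterns\<close>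

datatype ('u, 'b, 'l, 'v) gpattern =
    BGP "('u, 'b, 'l, 'v) triple_pattern fset"
  | And "('u, 'b, 'l, 'v) gpattern" "('u, 'b, 'l, 'v) gpattern"
  | Union "('u, 'b, 'l, 'v) gpattern" "('u, 'b, 'l, 'v) gpattern"
  | Opt "('u, 'b, 'l, 'v) gpattern" "('u, 'b, 'l, 'v) gpattern"
  | Filter "('u, 'b, 'l, 'v) gpattern" "('u, 'b, 'l, 'v) condition"
  | GraphUri 'u "('u, 'b, 'l, 'v) gpattern"
  | GraphVar 'v "('u, 'b, 'l, 'v) gpattern"
  | Bind "('u, 'b, 'l, 'v) gpattern" "('u, 'b, 'l, 'v) elem" 'v

primrec gp_vars :: "('u, 'b, 'l, 'v) gpattern \<Rightarrow> 'v set" where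
  "gp_vars (BGP B) = \<Union> (tp_vars ` fset B)"
| "gp_vars (And P1 P2) = gp_vars P1 \<union> gp_vars P2"
| "gp_vars (Union P1 P2) = gp_vars P1 \<union> gp_vars P2"
| "gp_vars (Opt P1 P2) = gp_vars P1 \<union> gp_vars P2"
| "gp_vars (Filter P1 R) = gp_vars P1 \<union> cond_vars R"
| "gp_vars (GraphUri u P1) = gp_vars P1"
| "gp_vars (GraphVar x P1) = insert x (gp_vars P1)"
| "gp_vars (Bind P1 e v) = insert v (elem_vars e \<union> gp_vars P1)"

primrec wf_gpattern :: "('u, 'b, 'l, 'v) gpattern \<Rightarrow> bool" where
  "wf_gpattern (BGP B) = (fset B \<subseteq> triple_patterns)"
| "wf_gpattern (And P1 P2) = (wf_gpattern P1 \<and> wf_gpattern P2)"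
| "wf_gpattern (Union P1 P2) = (wf_gpattern P1 \<and> wf_gpattern P2)"
| "wf_gpattern (Opt P1 P2) = (wf_gpattern P1 \<and> wf_gpattern P2)"
| "wf_gpattern (Filter P1 R) = (wf_gpattern P1 \<and> wf_condition R)"
| "wf_gpattern (GraphUri u P1) = wf_gpattern P1"
| "wf_gpattern (GraphVar x P1) = wf_gpattern P1"
| "wf_gpattern (Bind P1 e v) = (wf_gpattern P1 \<and> e \<in> pattern_elems \<and> v \<notin> gp_vars P1)"

primrec gp_tps :: "('u, 'b, 'l, 'v) gpattern \<Rightarrow> ('u, 'b, 'l, 'v) triple_pattern set" where
  "gp_tps (BGP B) = fset B"
| "gp_tps (And P1 P2) = gp_tps P1 \<union> gp_tps P2"
| "gp_tps (Union P1 P2) = gp_tps P1 \<union> gp_tps P2"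
| "gp_tps (Opt P1 P2) = gp_tps P1 \<union> gp_tps P2"
| "gp_tps (Filter P1 R) = gp_tps P1"
| "gp_tps (GraphUri u P1) = gp_tps P1"
| "gp_tps (GraphVar x P1) = gp_tps P1"
| "gp_tps (Bind P1 e v) = gp_tps P1"

subsection \<open>Evaluation\<close>

text \<open>Representing the named graphs by a partial function makes their names pairwise distinct.\<close>

record ('u, 'b, 'l) dataset =
  default_graph :: "('u, 'b, 'l) rdf_triple set"
  named_graphs :: "'u \<rightharpoonup> ('u, 'b, 'l) rdf_triple set"

definition graph_named :: "('u, 'b, 'l) dataset \<Rightarrow> 'u \<Rightarrow> ('u, 'b, 'l) rdf_triple set" where
  "graph_named DS u = (case named_graphs DS u of Some G \<Rightarrow> G | None \<Rightarrow> {})"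

definition bind_mapping ::
    "('u, 'b, 'l, 'v) elem \<Rightarrow> 'v \<Rightarrow> ('u, 'b, 'l, 'v) mapping \<Rightarrow> ('u, 'b, 'l, 'v) mapping" where
  "bind_mapping e v \<mu> = (case inst \<mu> e of Term t \<Rightarrow> \<mu>(v \<mapsto> t) | Var x \<Rightarrow> \<mu>)"

primrec eval_gp ::
    "('u, 'b, 'l) dataset \<Rightarrow> ('u, 'b, 'l, 'v) gpattern \<Rightarrow> ('u, 'b, 'l) rdf_triple set
      \<Rightarrow> ('u, 'b, 'l, 'v) mapping set" where
  "eval_gp DS (BGP B) G =
     {\<mu>. dom \<mu> = \<Union> (tp_vars ` fset B) \<and> inst_tp \<mu> ` fset B \<subseteq> emb ` G}"
| "eval_gp DS (And P1 P2) G = eval_gp DS P1 G \<Join> eval_gp DS P2 G"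
| "eval_gp DS (Union P1 P2) G = eval_gp DS P1 G \<union> eval_gp DS P2 G"
| "eval_gp DS (Opt P1 P2) G =
     (eval_gp DS P1 G \<Join> eval_gp DS P2 G) \<union>
     {\<mu> \<in> eval_gp DS P1 G. \<not> (\<exists>\<mu>' \<in> eval_gp DS P2 G. compatible \<mu> \<mu>')}"
| "eval_gp DS (Filter P1 R) G = {\<mu> \<in> eval_gp DS P1 G. satisfies \<mu> R}"
| "eval_gp DS (GraphUri u P1) G = eval_gp DS P1 (graph_named DS u)"
| "eval_gp DS (GraphVar x P1) G =
     (\<Union>u \<in> dom (named_graphs DS). eval_gp DS P1 (graph_named DS u) \<Join> {[x \<mapsto> Uri u]})"
| "eval_gp DS (Bind P1 e v) G = bind_mapping e v ` eval_gp DS P1 G"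

definition eval_graph ::
    "('u, 'b, 'l, 'v) gpattern \<Rightarrow> ('u, 'b, 'l) rdf_triple set \<Rightarrow> ('u, 'b, 'l, 'v) mapping set" where
  "eval_graph P G = eval_gp \<lparr>default_graph = G, named_graphs = Map.empty\<rparr> P G"


section \<open>LDQL\<close>

text \<open>\<open>Wild\<close> is the placeholder written as an underscore, \<open>Ctx\<close> the placeholder \<open>+\<close>.\<close>

datatype ('u, 'b, 'l) slot = Wild | Ctx | Const "('u, 'b, 'l) rdf_term"

type_synonym ('u, 'b, 'l) link_pattern =
  "('u, 'b, 'l) slot \<times> ('u, 'b, 'l) slot \<times> ('u, 'b, 'l) slot"

definition link_patterns :: "('u, 'b, 'l) link_pattern set" where
  "link_patterns =
     (let X = range (\<lambda>u. Const (Uri u)) \<union> {Wild, Ctx}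
      in X \<times> X \<times> (X \<union> range (\<lambda>l. Const (Lit l))))"

definition slot_matches :: "('u, 'b, 'l) slot \<Rightarrow> ('u, 'b, 'l) rdf_term \<Rightarrow> 'u \<Rightarrow> bool" where
  "slot_matches y x uc \<longleftrightarrow> (y = Ctx \<and> x = Uri uc) \<or> y = Const x \<or> y = Wild"

fun link_matches ::
    "('u, 'b, 'l) rdf_triple \<times> 'u \<Rightarrow> ('u, 'b, 'l) link_pattern \<Rightarrow> 'u \<Rightarrow> bool" where
  "link_matches ((x1, x2, x3), u) (y1, y2, y3) uc \<longleftrightarrow>
     ((y1 = Wild \<and> x1 = Uri u) \<or> (y2 = Wild \<and> x2 = Uri u) \<or> (y3 = Wild \<and> x3 = Uri u)) \<and>
     slot_matches y1 x1 uc \<and> slot_matches y2 x2 uc \<and> slot_matches y3 x3 uc"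

datatype ('u, 'b, 'l, 'v) query =
    Basic "('u, 'b, 'l, 'v) lpe" "('u, 'b, 'l, 'v) gpattern"
  | SeedUris "'u fset" "('u, 'b, 'l, 'v) query"
  | SeedVar 'v "('u, 'b, 'l, 'v) query"
  | QAnd "('u, 'b, 'l, 'v) query" "('u, 'b, 'l, 'v) query"
  | QUnion "('u, 'b, 'l, 'v) query" "('u, 'b, 'l, 'v) query"
  | Proj "'v fset" "('u, 'b, 'l, 'v) query"
and ('u, 'b, 'l, 'v) lpe =
    Eps
  | Link "('u, 'b, 'l) link_pattern"
  | Seq "('u, 'b, 'l, 'v) lpe" "('u, 'b, 'l, 'v) lpe"
  | Alt "('u, 'b, 'l, 'v) lpe" "('u, 'b, 'l, 'v) lpe"
  | Star "('u, 'b, 'l, 'v) lpe"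
  | Test "('u, 'b, 'l, 'v) lpe"
  | Sub 'v "('u, 'b, 'l, 'v) query"

primrec wf_query :: "('u, 'b, 'l, 'v) query \<Rightarrow> bool"
  and wf_lpe :: "('u, 'b, 'l, 'v) lpe \<Rightarrow> bool" where
  "wf_query (Basic lpe P) = (wf_lpe lpe \<and> wf_gpattern P)"
| "wf_query (SeedUris U q) = wf_query q"
| "wf_query (SeedVar v q) = wf_query q"
| "wf_query (QAnd q1 q2) = (wf_query q1 \<and> wf_query q2)"
| "wf_query (QUnion q1 q2) = (wf_query q1 \<and> wf_query q2)"
| "wf_query (Proj V q) = wf_query q"
| "wf_lpe Eps = True"
| "wf_lpe (Link lp) = (lp \<in> link_patterns)"
| "wf_lpe (Seq l1 l2) = (wf_lpe l1 \<and> wf_lpe l2)"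
| "wf_lpe (Alt l1 l2) = (wf_lpe l1 \<and> wf_lpe l2)"
| "wf_lpe (Star l) = wf_lpe l"
| "wf_lpe (Test l) = wf_lpe l"
| "wf_lpe (Sub v q) = wf_query q"

definition web_dataset :: "('u, 'b, 'l, 'd) web \<Rightarrow> 'u set \<Rightarrow> ('u, 'b, 'l) dataset" where
  "web_dataset W U =
     \<lparr>default_graph = (\<Union>u \<in> U \<inter> dom (adoc W). data W (the (adoc W u))),
      named_graphs = (map_option (data W) \<circ> adoc W) |` U\<rparr>"

text \<open>
  In the clause for \<open>Star\<close>, the \<open>n\<close>-th relation power is the \<open>n\<close>-fold composition \<open>l/\<dots>/l\<close>,
  with \<open>{uc}\<close> for \<open>n = 0\<close>.
\<close>

primrec eval_query ::
    "('u, 'b, 'l, 'd) web \<Rightarrow> ('u, 'b, 'l, 'v) query \<Rightarrow> 'u set \<Rightarrow> ('u, 'b, 'l, 'v) mapping set"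
  and eval_lpe :: "('u, 'b, 'l, 'd) web \<Rightarrow> ('u, 'b, 'l, 'v) lpe \<Rightarrow> 'u \<Rightarrow> 'u set" where
  "eval_query W (Basic lpe P) S =
     (let DS = web_dataset W (\<Union>u\<in>S. eval_lpe W lpe u) in eval_gp DS P (default_graph DS))"
| "eval_query W (SeedUris U q) S = eval_query W q (fset U)"
| "eval_query W (SeedVar v q) S = (\<Union>u. eval_query W q {u} \<Join> {[v \<mapsto> Uri u]})"
| "eval_query W (QAnd q1 q2) S = eval_query W q1 S \<Join> eval_query W q2 S"
| "eval_query W (QUnion q1 q2) S = eval_query W q1 S \<union> eval_query W q2 S"
| "eval_query W (Proj V q) S = (\<lambda>\<mu>. \<mu> |` fset V) ` eval_query W q S"
| "eval_lpe W Eps uc = (if uc \<in> dom (adoc W) then {uc} else {})"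
| "eval_lpe W (Link lp) uc = (if uc \<in> dom (adoc W) then
     {u. \<exists>t d'. (the (adoc W uc), (t, u), d') \<in> link_graph W \<and> link_matches (t, u) lp uc} else {})"
| "eval_lpe W (Seq l1 l2) uc = (if uc \<in> dom (adoc W) then
     (\<Union>u' \<in> eval_lpe W l1 uc. eval_lpe W l2 u') else {})"
| "eval_lpe W (Alt l1 l2) uc = (if uc \<in> dom (adoc W) then
     eval_lpe W l1 uc \<union> eval_lpe W l2 uc else {})"
| "eval_lpe W (Star l) uc = (if uc \<in> dom (adoc W) then
     (\<Union>n. ({(a, b). b \<in> eval_lpe W l a} ^^ n) `` {uc}) else {})"
| "eval_lpe W (Test l) uc = (if uc \<in> dom (adoc W) then
     (if eval_lpe W l uc \<noteq> {} then {uc} else {}) else {})"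
| "eval_lpe W (Sub v q) uc = (if uc \<in> dom (adoc W) then
     {u. \<exists>\<mu> \<in> eval_query W q {uc}. \<mu> v = Some (Uri u)} else {})"


section \<open>Reachability-based semantics\<close>

type_synonym ('u, 'b, 'l, 'v) criterion =
  "('u, 'b, 'l) rdf_triple \<Rightarrow> 'u \<Rightarrow> ('u, 'b, 'l, 'v) gpattern \<Rightarrow> bool"

definition c_All :: "('u, 'b, 'l, 'v) criterion" where
  "c_All t u P \<longleftrightarrow> True"

definition c_None :: "('u, 'b, 'l, 'v) criterion" where
  "c_None t u P \<longleftrightarrow> False"

definition c_Match :: "('u, 'b, 'l, 'v) criterion" where
  "c_Match t u P \<longleftrightarrow> (\<exists>tp \<in> gp_tps P. \<exists>\<mu>. is_solution_mapping \<mu> \<and> inst_tp \<mu> tp = emb t)"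

inductive_set reachable ::
    "('u, 'b, 'l, 'v) criterion \<Rightarrow> 'u set \<Rightarrow> ('u, 'b, 'l, 'v) gpattern \<Rightarrow> ('u, 'b, 'l, 'd) web \<Rightarrow> 'd set"
  for c S P W where
  seed: "u \<in> S \<Longrightarrow> adoc W u = Some d \<Longrightarrow> d \<in> reachable c S P W"
| link: "(d, (t, u), d') \<in> link_graph W \<Longrightarrow> d \<in> reachable c S P W \<Longrightarrow> c t u P
           \<Longrightarrow> d' \<in> reachable c S P W"

definition eval_reach ::
    "('u, 'b, 'l, 'v) criterion \<Rightarrow> 'u set \<Rightarrow> ('u, 'b, 'l, 'v) gpattern \<Rightarrow> ('u, 'b, 'l, 'd) web
      \<Rightarrow> ('u, 'b, 'l, 'v) mapping set" where
  "eval_reach c S P W = eval_graph P (\<Union>d \<in> reachable c S P W. data W d)"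

end

theory Submission
  imports Defs
begin

text \<open>
  Each of the three criteria has the form ``\<open>t\<close> is an instance of one of finitely many triple
  patterns'': no pattern for \<open>c_None\<close>, three distinct variables for \<open>c_All\<close>. A single link path
  expression can follow the qualifying links: \<open>\<langle>?v, \<langle>\<epsilon>, tp BIND (e AS ?v)\<rangle>\<rangle>\<close> with \<open>?v\<close> fresh
  yields the URIs at the position of \<open>e\<close> in the triples of the current document that match \<open>tp\<close>.
  Subqueries are essential here, since link patterns cannot express that a variable is repeated.
  The Kleene star then reaches the documents on which \<open>P\<close> is to be evaluated. The LDQL dataset has
  named graphs whereas the reachability semantics has none, so \<open>GRAPH\<close> must be compiled away.
\<close>

section \<open>Eliminating GRAPH\<close>

text \<open>RDF triples have no literal as subject.\<close>

definition no_match :: "('u, 'b, 'l, 'v) gpattern" where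
  "no_match = BGP {|(Term (Lit undefined), Term (Uri undefined), Term (Lit undefined))|}"

lemma wf_no_match: "wf_gpattern no_match"
  by (auto simp: no_match_def triple_patterns_def pattern_elems_def)

lemma gp_vars_no_match: "gp_vars no_match = {}"
  by (simp add: no_match_def)

lemma eval_no_match:
  assumes "G \<subseteq> rdf_triples"
  shows "eval_gp DS no_match G = {}"
  using assms by (auto simp: no_match_def rdf_triples_def)

text \<open>The flag records whether the pattern is to be evaluated over the empty graph.\<close>

primrec ungraph :: "bool \<Rightarrow> ('u, 'b, 'l, 'v) gpattern \<Rightarrow> ('u, 'b, 'l, 'v) gpattern" where
  "ungraph e (BGP B) = (if e \<and> B \<noteq> {||} then no_match else BGP B)"
| "ungraph e (And P1 P2) = And (ungraph e P1) (ungraph e P2)"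
| "ungraph e (Union P1 P2) = Union (ungraph e P1) (ungraph e P2)"
| "ungraph e (Opt P1 P2) = Opt (ungraph e P1) (ungraph e P2)"
| "ungraph e (Filter P1 R) = Filter (ungraph e P1) R"
| "ungraph e (GraphUri u P1) = ungraph True P1"
| "ungraph e (GraphVar x P1) = no_match"
| "ungraph e (Bind P1 t v) = Bind (ungraph e P1) t v"

lemma gp_vars_ungraph: "gp_vars (ungraph e P) \<subseteq> gp_vars P"
  by (induction P arbitrary: e) (simp add: gp_vars_no_match; blast)+

lemma wf_ungraph: "wf_gpattern P \<Longrightarrow> wf_gpattern (ungraph e P)"
  by (induction P arbitrary: e) (auto simp: wf_no_match dest: subsetD[OF gp_vars_ungraph])

text \<open>Without named graphs, \<open>GRAPH\<close> with a URI switches to the empty graph, which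
  no inner pattern can leave, and \<open>GRAPH\<close> with a variable ranges over no names. Over
  the empty graph only the empty basic pattern has a solution; \<open>no_match\<close> simulates the
  others while evaluation stays on \<open>G\<close>. The result contains no \<open>GRAPH\<close>, so
  \<open>DS\<close> is never consulted.\<close>

lemma eval_ungraph:
  assumes "G \<subseteq> rdf_triples" and "named_graphs DS0 = Map.empty"
  shows "eval_gp DS (ungraph e P) G = eval_gp DS0 P (if e then {} else G)"
proof (induction P arbitrary: e)
  case (BGP B)
  then show ?case
    using eval_no_match[OF assms(1)] by auto
next
  case (GraphUri u P)
  then show ?case
    by (simp add: graph_named_def assms(2))
next
  case (GraphVar x P)
  then show ?case
    using eval_no_match[OF assms(1)] by (simp add: assms(2))
qed simp_all

section \<open>Following links\<close>

definition matches :: "('u, 'b, 'l, 'v) triple_pattern \<Rightarrow> ('u, 'b, 'l) rdf_triple \<Rightarrow> bool" where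
  "matches tp t \<longleftrightarrow> (\<exists>\<mu>. is_solution_mapping \<mu> \<and> inst_tp \<mu> tp = emb t)"

lemma finite_tp_vars:
  fixes tp :: "('u, 'b, 'l, 'v) triple_pattern"
  shows "finite (tp_vars tp)"
proof -
  have "finite (elem_vars e)" for e :: "('u, 'b, 'l, 'v) elem"
    by (cases e) auto
  then show ?thesis
    by (cases tp) auto
qed

lemma inst_eq_Term_dom: "inst \<mu> e = Term x \<Longrightarrow> elem_vars e \<subseteq> dom \<mu>"
  by (cases e) (auto split: option.splits)

lemma inst_restrict: "elem_vars e \<subseteq> V \<Longrightarrow> inst (\<mu> |` V) e = inst \<mu> e"
  by (cases e) auto

text \<open>Links the criterion, which allows any finite domain, to BGP evaluation, which fixes it:
  a witness binds all variables of the pattern and can be cut down to them.\<close>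

lemma matches_iff: "matches tp t \<longleftrightarrow> (\<exists>\<mu>. dom \<mu> = tp_vars tp \<and> inst_tp \<mu> tp = emb t)"
proof
  assume "matches tp t"
  then obtain \<mu> where \<mu>: "inst_tp \<mu> tp = emb t"
    by (auto simp: matches_def)
  obtain e1 e2 e3 where tp: "tp = (e1, e2, e3)"
    by (cases tp)
  have "tp_vars tp \<subseteq> dom \<mu>"
    using \<mu> by (cases t) (auto simp: tp dest: inst_eq_Term_dom)
  moreover have "inst_tp (\<mu> |` tp_vars tp) tp = inst_tp \<mu> tp"
    unfolding tp inst_tp.simps by (intro arg_cong2[where f = Pair] inst_restrict) auto
  ultimately show "\<exists>\<mu>. dom \<mu> = tp_vars tp \<and> inst_tp \<mu> tp = emb t"
    using \<mu> by (intro exI[of _ "\<mu> |` tp_vars tp"]) auto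
next
  assume "\<exists>\<mu>. dom \<mu> = tp_vars tp \<and> inst_tp \<mu> tp = emb t"
  then show "matches tp t"
    by (metis matches_def is_solution_mapping_def finite_tp_vars)
qed

definition sub_match ::
    "('u, 'b, 'l, 'v) triple_pattern \<Rightarrow> ('u, 'b, 'l, 'v) elem \<Rightarrow> 'v \<Rightarrow> ('u, 'b, 'l, 'v) lpe" where
  "sub_match tp e v = Sub v (Basic Eps (Bind (BGP {|tp|}) e v))"

text \<open>From seed \<open>a\<close>, \<epsilon> selects only the document \<open>d\<close>. As
  \<open>v\<close> is fresh, BIND stores there exactly the instance of \<open>e\<close>, and the
  subquery keeps its URI values.\<close>

lemma eval_sub_match:
  fixes tp :: "('u, 'b, 'l, 'v) triple_pattern"
  assumes "v \<notin> tp_vars tp" "elem_vars e \<subseteq> tp_vars tp" "adoc W a = Some d"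
  shows "eval_lpe W (sub_match tp e v) a =
    {u. \<exists>t\<in>data W d. \<exists>\<mu>. dom \<mu> = tp_vars tp \<and> inst_tp \<mu> tp = emb t \<and> inst \<mu> e = Term (Uri u)}"
proof -
  have bind: "bind_mapping e v \<mu> v = Some (Uri u) \<longleftrightarrow> inst \<mu> e = Term (Uri u)"
    if "dom \<mu> = tp_vars tp" for \<mu> :: "('u, 'b, 'l, 'v) mapping" and u
    using that assms(1,2) by (cases e) (auto simp: bind_mapping_def split: option.splits)
  show ?thesis
    using assms(3)
    by (auto simp: sub_match_def web_dataset_def bind Let_def dom_def[of "adoc W"])
qed

text \<open>Includes URIs without a document, unlike edges of the link graph. These are harmless: no
  step continues from them and they contribute no data.\<close>

definition link_targets ::
    "('u, 'b, 'l, 'v) triple_pattern set \<Rightarrow> ('u, 'b, 'l, 'd) web \<Rightarrow> 'u \<Rightarrow> 'u set" where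
  "link_targets T W a =
     {u. \<exists>d. adoc W a = Some d \<and> (\<exists>t\<in>data W d. (\<exists>tp\<in>T. matches tp t) \<and> u \<in> uris t)}"

lemma single_pattern_lpe:
  fixes tp :: "('u, 'b, 'l, 'v::infinite) triple_pattern"
  assumes "tp \<in> triple_patterns"
  shows "\<exists>l :: ('u, 'b, 'l, 'v) lpe. wf_lpe l \<and>
    (\<forall>(W :: ('u, 'b, 'l, 'd) web) a. eval_lpe W l a = link_targets {tp} W a)"
proof -
  obtain v where v: "v \<notin> tp_vars tp"
    using ex_new_if_finite[OF infinite_UNIV finite_tp_vars] by blast
  obtain e1 e2 e3 where tp: "tp = (e1, e2, e3)"
    by (cases tp)
  define l where "l = Alt (sub_match tp e1 v) (Alt (sub_match tp e2 v) (sub_match tp e3 v))"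
  have "wf_lpe l"
    using assms v by (auto simp: l_def sub_match_def tp triple_patterns_def pattern_elems_def)
  moreover have "eval_lpe W l a = link_targets {tp} W a"
    for W :: "('u, 'b, 'l, 'd) web" and a
  proof (cases "adoc W a")
    case None
    then show ?thesis
      by (simp add: l_def dom_def link_targets_def)
  next
    case a: (Some d)
    have "u \<in> eval_lpe W l a \<longleftrightarrow> (\<exists>t\<in>data W d. matches tp t \<and> u \<in> uris t)" for u
    proof -
      have "u \<in> eval_lpe W l a \<longleftrightarrow>
          (\<exists>t\<in>data W d. \<exists>\<mu>. dom \<mu> = tp_vars tp \<and> inst_tp \<mu> tp = emb t \<and>
             (inst \<mu> e1 = Term (Uri u) \<or> inst \<mu> e2 = Term (Uri u) \<or> inst \<mu> e3 = Term (Uri u)))"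
      proof -
        have "elem_vars e1 \<subseteq> tp_vars tp" "elem_vars e2 \<subseteq> tp_vars tp" "elem_vars e3 \<subseteq> tp_vars tp"
          by (auto simp: tp)
        note eval = this[THEN eval_sub_match[OF v _ a]]
        show ?thesis
          unfolding l_def eval_lpe.simps using a by (simp add: domI eval) blast
      qed
      also have "\<dots> \<longleftrightarrow> (\<exists>t\<in>data W d. \<exists>\<mu>. dom \<mu> = tp_vars tp \<and> inst_tp \<mu> tp = emb t \<and> u \<in> uris t)"
      proof (intro bex_cong refl ex_cong1 conj_cong)
        fix t and \<mu> :: "('u, 'b, 'l, 'v) mapping"
        assume "inst_tp \<mu> tp = emb t"
        then show "(inst \<mu> e1 = Term (Uri u) \<or> inst \<mu> e2 = Term (Uri u) \<or> inst \<mu> e3 = Term (Uri u))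
            \<longleftrightarrow> u \<in> uris t"
          by (cases t) (auto simp: tp uris_def)
      qed
      finally show ?thesis
        by (auto simp: matches_iff)
    qed
    then show ?thesis
      using a by (auto simp: link_targets_def)
  qed
  ultimately show ?thesis
    by (intro exI[of _ l]) simp
qed

lemma patterns_lpe:
  fixes T :: "('u, 'b, 'l, 'v::infinite) triple_pattern set"
  assumes "finite T" "T \<subseteq> triple_patterns"
  shows "\<exists>l :: ('u, 'b, 'l, 'v) lpe. wf_lpe l \<and>
    (\<forall>(W :: ('u, 'b, 'l, 'd) web) a. eval_lpe W l a = link_targets T W a)"
  using assms
proof (induction T rule: finite_induct)
  case empty
  \<comment> \<open>A link pattern without wildcard matches no edge.\<close>
  show ?case
    by (rule exI[of _ "Link (Ctx, Ctx, Ctx)"])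
      (auto simp: link_targets_def link_patterns_def Let_def)
next
  case (insert tp T)
  from insert.prems insert.IH obtain l :: "('u, 'b, 'l, 'v) lpe" where l: "wf_lpe l"
    "\<forall>(W :: ('u, 'b, 'l, 'd) web) a. eval_lpe W l a = link_targets T W a"
    by auto
  from insert.prems have "tp \<in> triple_patterns"
    by simp
  from single_pattern_lpe[OF this] obtain k :: "('u, 'b, 'l, 'v) lpe" where k: "wf_lpe k"
    "\<forall>(W :: ('u, 'b, 'l, 'd) web) a. eval_lpe W k a = link_targets {tp} W a"
    by auto
  have "eval_lpe W (Alt k l) a = link_targets (insert tp T) W a"
    for W :: "('u, 'b, 'l, 'd) web" and a
    by (auto simp: k l) (auto simp: link_targets_def)
  then show ?case
    using k l by (intro exI[of _ "Alt k l"]) simp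
qed

text \<open>Reachability walks over documents, the star over URIs. Both walks correspond because the
  links followed from a URI depend only on its document.\<close>

lemma reachable_iff_star:
  assumes "is_web W"
    and c: "\<And>t u. c t u P \<longleftrightarrow> (\<exists>tp\<in>T. matches tp t)"
    and l: "\<And>a. eval_lpe W l a = link_targets T W a"
  shows "d \<in> reachable c S P W \<longleftrightarrow> (\<exists>s\<in>S. \<exists>u\<in>eval_lpe W (Star l) s. adoc W u = Some d)"
proof -
  define R where "R = {(a, b). b \<in> eval_lpe W l a}"
  have star: "eval_lpe W (Star l) s = (if s \<in> dom (adoc W) then R\<^sup>* `` {s} else {})" for s
    by (auto simp: R_def rtrancl_is_UN_relpow)
  \<comment> \<open>Link graph edges must start in \<open>docs W\<close>, which holds the range of
    \<open>adoc W\<close>.\<close>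
  have docs: "adoc W a = Some d \<Longrightarrow> d \<in> docs W" for a d
    using assms(1) by (auto simp: is_web_def intro: ranI)
  show ?thesis
  proof
    assume "d \<in> reachable c S P W"
    then show "\<exists>s\<in>S. \<exists>u\<in>eval_lpe W (Star l) s. adoc W u = Some d"
    proof induction
      case (seed u d)
      then show ?case
        unfolding star by (intro bexI[of _ u]) auto
    next
      case (link d t u d')
      then obtain s a where s: "s \<in> S" "s \<in> dom (adoc W)" "(s, a) \<in> R\<^sup>*" "adoc W a = Some d"
        unfolding star by (auto split: if_splits)
      \<comment> \<open>Here \<open>a\<close> may be any URI whose document is \<open>d\<close>, not
        necessarily the one in the link that led to \<open>d\<close>.\<close>
      have "(a, u) \<in> R"
        using link.hyps s(4) by (auto simp: R_def l link_targets_def c link_graph_def)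
      then have "(s, u) \<in> R\<^sup>*"
        using s(3) by simp
      then show ?case
        using link.hyps s(1,2) unfolding star by (auto simp: link_graph_def)
    qed
  next
    assume "\<exists>s\<in>S. \<exists>u\<in>eval_lpe W (Star l) s. adoc W u = Some d"
    then obtain s u where s: "s \<in> S" and "(s, u) \<in> R\<^sup>*" and u: "adoc W u = Some d"
      unfolding star by (auto split: if_splits)
    from this(2,3) show "d \<in> reachable c S P W"
    \<comment> \<open>The document varies with the URI along the walk.\<close>
    proof (induction arbitrary: d rule: rtrancl_induct)
      case base
      then show ?case
        using s by (rule reachable.seed[rotated])
    next
      case (step a b)
      from step.hyps(2) obtain d0 t where a: "adoc W a = Some d0"
        and t: "t \<in> data W d0" "c t b P" "b \<in> uris t"
        unfolding R_def l link_targets_def c by blast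
      then have "(d0, (t, b), d) \<in> link_graph W"
        using docs[OF a] step.prems unfolding link_graph_def by blast
      then show ?case
        using step.IH[OF a] t(2) by (rule reachable.link)
    qed
  qed
qed

section \<open>The translation\<close>

lemma finite_gp_tps: "finite (gp_tps P)"
  by (induction P) auto

lemma gp_tps_subset: "wf_gpattern P \<Longrightarrow> gp_tps P \<subseteq> triple_patterns"
  by (induction P) auto

lemma three_vars_match:
  assumes "x \<noteq> y" "x \<noteq> z" "y \<noteq> z"
  shows "matches (Var x, Var y, Var z) t"
proof (cases t)
  case (fields t1 t2 t3)
  then show ?thesis
    using assms unfolding matches_def
    by (intro exI[of _ "[x \<mapsto> t1, y \<mapsto> t2, z \<mapsto> t3]"]) (simp add: is_solution_mapping_def)
qed

lemma criterion_matches: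
  fixes P :: "('u, 'b, 'l, 'v::infinite) gpattern"
  assumes "c \<in> {c_All, c_None, c_Match}" "wf_gpattern P"
  obtains T :: "('u, 'b, 'l, 'v) triple_pattern set" where "finite T" "T \<subseteq> triple_patterns"
    "\<And>t u. c t u P \<longleftrightarrow> (\<exists>tp\<in>T. matches tp t)"
proof -
  consider "c = c_All" | "c = c_None" | "c = c_Match"
    using assms(1) by blast
  then show thesis
  proof cases
    case 1
    \<comment> \<open>The variables must be distinct, since a repeated one would force two positions
      of the triple to agree.\<close>
    obtain V :: "'v set" where "card V = 3"
      using infinite_arbitrarily_large[OF infinite_UNIV] by blast
    then obtain x y z :: 'v where xyz: "x \<noteq> y" "x \<noteq> z" "y \<noteq> z"
      by (auto simp: card_3_iff)
    show thesis
      by (rule that[of "{(Var x, Var y, Var z)}"])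
        (auto simp: 1 c_All_def three_vars_match[OF xyz] triple_patterns_def pattern_elems_def)
  next
    case 2
    show thesis
      by (rule that[of "{}"]) (auto simp: 2 c_None_def)
  next
    case 3
    show thesis
      by (rule that[of "gp_tps P"])
        (simp_all add: 3 c_Match_def matches_def finite_gp_tps gp_tps_subset assms(2))
  qed
qed

theorem theorem5:
  fixes c :: "('u::infinite, 'b::infinite, 'l::infinite, 'v::infinite) criterion"
    and P :: "('u, 'b, 'l, 'v) gpattern"
  assumes "c \<in> {c_All, c_None, c_Match}"
    and "wf_gpattern P"
  shows "\<exists>q :: ('u, 'b, 'l, 'v) query. wf_query q \<and>
    (\<forall>(W :: ('u, 'b, 'l, 'd::infinite) web) S. is_web W \<longrightarrow> finite S \<longrightarrow>
       eval_reach c S P W = eval_query W q S)"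
proof -
  obtain T :: "('u, 'b, 'l, 'v) triple_pattern set" where T: "finite T" "T \<subseteq> triple_patterns"
    and c: "\<And>t u. c t u P \<longleftrightarrow> (\<exists>tp\<in>T. matches tp t)"
    using criterion_matches[OF assms] by blast
  from patterns_lpe[OF T] obtain l :: "('u, 'b, 'l, 'v) lpe" where wf: "wf_lpe l"
    and l: "\<forall>(W :: ('u, 'b, 'l, 'd) web) a. eval_lpe W l a = link_targets T W a"
    by auto
  \<comment> \<open>\<open>T\<close> and \<open>l\<close> depend only on \<open>c\<close> and
    \<open>P\<close>, so one query serves every \<open>W\<close> and \<open>S\<close>. The flag is
    \<open>False\<close> because \<open>P\<close> itself is evaluated over the full graph.\<close>
  define q where "q = Basic (Star l) (ungraph False P)"
  have "eval_reach c S P W = eval_query W q S"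
    if W: "is_web W" for W :: "('u, 'b, 'l, 'd) web" and S
  proof -
    define U where "U = (\<Union>s\<in>S. eval_lpe W (Star l) s)"
    define G where "G = (\<Union>d \<in> reachable c S P W. data W d)"
    have "reachable c S P W = {d. \<exists>u\<in>U. adoc W u = Some d}"
      using reachable_iff_star[where l = l and T = T and c = c and P = P, OF W c l[rule_format]] unfolding U_def by blast
    then have default: "default_graph (web_dataset W U) = G"
      by (force simp: G_def web_dataset_def dom_def)
    have "G \<subseteq> rdf_triples"
      using W unfolding G_def is_web_def by blast
    then show ?thesis
      unfolding q_def eval_query.simps Let_def U_def[symmetric] default eval_reach_def
        eval_graph_def G_def[symmetric]
      by (subst eval_ungraph) simp_all
  qed
  moreover have "wf_query q"
    by (simp add: q_def wf wf_ungraph assms(2))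
  ultimately show ?thesis
    by blast
qed

end
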